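(* The operator $C$ is spectrally coercive if and only if there exist functions $\Psi,\varepsilon\in\Sigma_d$ such that the following resolvent inequality holds: $$\lVert z\rVert_X^2\le \sup\Big\{\frac{\lVert Cz\rVert_Y^2}{\Psi(\lambda_{|A|}(z))},\ \frac{\lVert (A-\lambda I)z\rVert_X^2}{(\lambda-\lambda_A(z))^2+\varepsilon(\lambda_{|A|}(z))}\Big\},\qquad \forall \lambda\in\mathbb{R},\ \forall z\in D(A)\setminus\{0\}.$$
   Context: Setting. $H$ and $Y$ are complex Hilbert spaces. $A_0:D(A_0)\subset H\to H$ is an unbounded self-adjoint positive operator with compact resolvent. For $\beta\ge 0$, $H_\beta=D(A_0^{\beta/2})$ with norm $\|u\|_{H_\beta}=\|A_0^{\beta/2}u\|_H$ (so $H_2=D(A_0)$, $H_1=D(A_0^{1/2})$). $(\lambda_k)_{k\in\mathbb{N}^*}$ is the non-decreasing sequence of (positive) eigenvalues of $A_0^{1/2}$, and $(\phi_k)_{k\in\mathbb{N}^*}$ is a corresponding orthonormal basis of eigenvectors in $H$. $C_0\in\mathcal L(D(A_0),Y)$ is a bounded linear operator. Let $X=H_1\times H$ with the product norm $\|(u,v)\|_X^2=\|A_0^{1/2}u\|_H^2+\|v\|_H^2$, and $$A=-i\begin{pmatrix}0&I\\-A_0&0\end{pmatrix},\quad D(A)=D(A_0)\times H_1,\qquad C=\begin{pmatrix}C_0&0\end{pmatrix}\in\mathcal L(D(A),Y),$$ so $A(u,v)=(-iv,\,iA_0u)$ is self-adjoint on $X$ with compact resolvent, and $C(u,v)=C_0u$.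 Standing assumption: $C$ is admissible, i.e. for every $T>0$ there is $C_T>0$ with $\int_0^T\|Ce^{itA}z_0\|_Y^2dt\le C_T\|z_0\|_X^2$ for all $z_0\in D(A)$ ($C_T$ taken non-decreasing in $T$). Eigenpairs of $A$: for $k\in\mathbb{Z}^*=\mathbb{Z}\setminus\{0\}$, $\mu_k=\operatorname{sign}(k)\lambda_{|k|}$ and $\psi_k=\frac1{\sqrt2}\big(\frac1{i\mu_k}\phi_{|k|},\phi_{|k|}\big)^t$; $(\psi_k)$ is an orthonormal basis of $X$ with $A\psi_k=\mu_k\psi_k$. Frequency functions: for $z\in D(A)\setminus\{0\}$, $$\lambda_A(z)=\frac{\langle Az,z\rangle_X}{\|z\|_X^2}=\frac{\sum_{k\in\mathbb{Z}^*}\mu_k|\langle z,\psi_k\rangle_X|^2}{\sum_{k\in\mathbb{Z}^*}|\langle z,\psi_k\rangle_X|^2},\qquad \lambda_{|A|}(z)=\frac{\sum_{k\in\mathbb{Z}^*}\lambda_{|k|}|\langle z,\psi_k\rangle_X|^2}{\sum_{k\in\mathbb{Z}^*}|\langle z,\psi_k\rangle_X|^2}.$$ $\Sigma_d$ is the set of functions $\mathbb{R}\to(0,\infty)$ that are even, continuous, and non-increasing on $[0,\infty)$. Spectral coercivity: $C$ is spectrally coercive if there exist $\varepsilon,\Psi\in\Sigma_d$ such that, whenever $z\in D(A)\setminus\{0\}$ satisfies $\frac{\|Az\|_X^2}{\|z\|_X^2}-\lambda_A^2(z)\le\varepsilon(\lambda_{|A|}(z))$, one has $\|Cz\|_Y^2\ge\Psi(\lambda_{|A|}(z))\|z\|_X^2$.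 *)

theory Defs
  imports "HOL-Analysis.Analysis"
begin

(* Complex Hilbert spaces.  The inner product is linear in its first argument. *)
class chilbert_space = banach +
  fixes scaleC :: "complex \<Rightarrow> 'a \<Rightarrow> 'a"  (infixr "*\<^sub>C" 75)
    and cinner :: "'a \<Rightarrow> 'a \<Rightarrow> complex"
  assumes scaleC_add_right: "c *\<^sub>C (x + y) = c *\<^sub>C x + c *\<^sub>C y"
    and scaleC_add_left: "(c + d) *\<^sub>C x = c *\<^sub>C x + d *\<^sub>C x"
    and scaleC_scaleC: "c *\<^sub>C d *\<^sub>C x = (c * d) *\<^sub>C x"
    and scaleC_of_real: "complex_of_real r *\<^sub>C x = r *\<^sub>R x"
    and cinner_add_left: "cinner (x + y) z = cinner x z + cinner y z"
    and cinner_scaleC_left: "cinner (c *\<^sub>C x) y = c * cinner x y"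
    and cinner_commute: "cinner x y = cnj (cinner y x)"
    and norm_eq_sqrt_cinner: "norm x = sqrt (Re (cinner x x))"

section \<open>Unbounded operators\<close>

text \<open>An operator is given by its domain \<open>D\<close> and a total function \<open>T\<close> of which
  only the restriction to \<open>D\<close> is relevant.\<close>

definition clinear_on :: "'a::chilbert_space set \<Rightarrow> ('a \<Rightarrow> 'b::chilbert_space) \<Rightarrow> bool" where
  "clinear_on D T \<longleftrightarrow>
     0 \<in> D \<and> (\<forall>x\<in>D. \<forall>y\<in>D. x + y \<in> D) \<and> (\<forall>c. \<forall>x\<in>D. c *\<^sub>C x \<in> D) \<and>
     (\<forall>x\<in>D. \<forall>y\<in>D. T (x + y) = T x + T y) \<and> (\<forall>c. \<forall>x\<in>D. T (c *\<^sub>C x) = c *\<^sub>C T x)"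

definition adjoint_dom :: "'a::chilbert_space set \<Rightarrow> ('a \<Rightarrow> 'a) \<Rightarrow> 'a set" where
  "adjoint_dom D T = {v. \<exists>w. \<forall>u\<in>D. cinner (T u) v = cinner u w}"

definition self_adjoint :: "'a::chilbert_space set \<Rightarrow> ('a \<Rightarrow> 'a) \<Rightarrow> bool" where
  "self_adjoint D T \<longleftrightarrow>
     clinear_on D T \<and> closure D = UNIV \<and> adjoint_dom D T = D \<and>
     (\<forall>u\<in>D. \<forall>v\<in>D. cinner (T u) v = cinner u (T v))"

(* For self-adjoint T the number cinner (T u) u is real. *)
definition positive_op :: "'a::chilbert_space set \<Rightarrow> ('a \<Rightarrow> 'a) \<Rightarrow> bool" where
  "positive_op D T \<longleftrightarrow> (\<forall>u\<in>D. u \<noteq> 0 \<longrightarrow> Re (cinner (T u) u) > 0)"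

definition unbounded_op :: "'a::chilbert_space set \<Rightarrow> ('a \<Rightarrow> 'a) \<Rightarrow> bool" where
  "unbounded_op D T \<longleftrightarrow> \<not> (\<exists>K. \<forall>u\<in>D. norm (T u) \<le> K * norm u)"

definition compact_resolvent :: "'a::chilbert_space set \<Rightarrow> ('a \<Rightarrow> 'a) \<Rightarrow> bool" where
  "compact_resolvent D T \<longleftrightarrow>
     (\<exists>m::complex. let S = (\<lambda>u. T u - m *\<^sub>C u) in
        bij_betw S D UNIV \<and> compact (closure (inv_into D S ` cball 0 1)))"

text \<open>\<open>(D1, B)\<close> is the positive self-adjoint square root of \<open>(D0, A0)\<close>; it is unique,
  and \<open>D1\<close> is the space \<open>H\<^sub>1\<close>.\<close>

definition positive_sqrt_of ::
  "'a::chilbert_space set \<Rightarrow> ('a \<Rightarrow> 'a) \<Rightarrow> 'a set \<Rightarrow> ('a \<Rightarrow> 'a) \<Rightarrow> bool" where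
  "positive_sqrt_of D0 A0 D1 B \<longleftrightarrow>
     self_adjoint D1 B \<and> positive_op D1 B \<and>
     D0 = {u \<in> D1. B u \<in> D1} \<and> (\<forall>u\<in>D0. A0 u = B (B u))"

text \<open>Sequences over the positive integers are functions on \<open>nat\<close> whose value at \<open>0\<close>
  is irrelevant.  Being a basis, \<open>phi\<close> makes \<open>lam\<close> exhaust the eigenvalues, repeated
  according to multiplicity.\<close>

definition orthonormal_basis :: "(nat \<Rightarrow> 'a::chilbert_space) \<Rightarrow> bool" where
  "orthonormal_basis phi \<longleftrightarrow>
     (\<forall>j\<ge>1. \<forall>k\<ge>1. cinner (phi j) (phi k) = (if j = k then 1 else 0)) \<and>
     (\<forall>x. ((\<lambda>k. cinner x (phi k) *\<^sub>C phi k) has_sum x) {1..})"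

definition ordered_eigenbasis ::
  "'a::chilbert_space set \<Rightarrow> ('a \<Rightarrow> 'a) \<Rightarrow> (nat \<Rightarrow> real) \<Rightarrow> (nat \<Rightarrow> 'a) \<Rightarrow> bool" where
  "ordered_eigenbasis D T lam phi \<longleftrightarrow>
     mono_on {1..} lam \<and> orthonormal_basis phi \<and>
     (\<forall>k\<ge>1. phi k \<in> D \<and> T (phi k) = lam k *\<^sub>R phi k)"

text \<open>Boundedness with respect to the norm \<open>norm (A0 u)\<close> of \<open>D(A0)\<close>.\<close>

definition bounded_clinear_on_graph ::
  "'a::chilbert_space set \<Rightarrow> ('a \<Rightarrow> 'a) \<Rightarrow> ('a \<Rightarrow> 'b::chilbert_space) \<Rightarrow> bool" where
  "bounded_clinear_on_graph D0 A0 C0 \<longleftrightarrow>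
     clinear_on D0 C0 \<and> (\<exists>K. \<forall>u\<in>D0. norm (C0 u) \<le> K * norm (A0 u))"

section \<open>The first-order system on \<open>X = H\<^sub>1 \<times> H\<close>\<close>

text \<open>\<open>X\<close> is the subset \<open>D1 \<times> UNIV\<close> of the product type, with the inner product and norm
  below; the product type's own norm is not the norm of \<open>X\<close>.  Throughout, \<open>B\<close> stands for
  the square root of \<open>A0\<close>.\<close>

definition X_inner ::
  "('a::chilbert_space \<Rightarrow> 'a) \<Rightarrow> 'a \<times> 'a \<Rightarrow> 'a \<times> 'a \<Rightarrow> complex" where
  "X_inner B z w = cinner (B (fst z)) (B (fst w)) + cinner (snd z) (snd w)"

definition X_norm :: "('a::chilbert_space \<Rightarrow> 'a) \<Rightarrow> 'a \<times> 'a \<Rightarrow> real" where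
  "X_norm B z = sqrt ((norm (B (fst z)))\<^sup>2 + (norm (snd z))\<^sup>2)"

definition dom_A :: "'a set \<Rightarrow> 'a set \<Rightarrow> ('a \<times> 'a) set" where
  "dom_A D0 D1 = D0 \<times> D1"

definition op_A :: "('a::chilbert_space \<Rightarrow> 'a) \<Rightarrow> 'a \<times> 'a \<Rightarrow> 'a \<times> 'a" where
  "op_A A0 z = (- \<i> *\<^sub>C snd z, \<i> *\<^sub>C A0 (fst z))"

definition op_C :: "('a \<Rightarrow> 'b) \<Rightarrow> 'a \<times> 'a \<Rightarrow> 'b" where
  "op_C C0 z = C0 (fst z)"

definition pair_scaleC :: "complex \<Rightarrow> 'a::chilbert_space \<times> 'a \<Rightarrow> 'a \<times> 'a" where
  "pair_scaleC c z = (c *\<^sub>C fst z, c *\<^sub>C snd z)"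

definition mu :: "(nat \<Rightarrow> real) \<Rightarrow> int \<Rightarrow> real" where
  "mu lam k = of_int (sgn k) * lam (nat \<bar>k\<bar>)"

definition psi ::
  "(nat \<Rightarrow> real) \<Rightarrow> (nat \<Rightarrow> 'a::chilbert_space) \<Rightarrow> int \<Rightarrow> 'a \<times> 'a" where
  "psi lam phi k = pair_scaleC (1 / complex_of_real (sqrt 2))
     ((1 / (\<i> * complex_of_real (mu lam k))) *\<^sub>C phi (nat \<bar>k\<bar>), phi (nat \<bar>k\<bar>))"

text \<open>The unitary group \<open>e\<^sup>i\<^sup>t\<^sup>A\<close> through its expansion in the eigenbasis \<open>psi\<close>.  For \<open>z\<close>
  in \<open>X\<close> the series converges unconditionally in \<open>X\<close>.  As \<open>X\<close> embeds continuously into the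
  product space (the smallest eigenvalue is positive), its sum there, which is what \<open>infsum\<close>
  computes, is the sum in \<open>X\<close>.\<close>

definition exp_itA ::
  "('a::chilbert_space \<Rightarrow> 'a) \<Rightarrow> (nat \<Rightarrow> real) \<Rightarrow> (nat \<Rightarrow> 'a) \<Rightarrow> real \<Rightarrow> 'a \<times> 'a \<Rightarrow> 'a \<times> 'a" where
  "exp_itA B lam phi t z =
     (\<Sum>\<^sub>\<infinity>k\<in>-{0}. pair_scaleC (exp (\<i> * complex_of_real (t * mu lam k)) * X_inner B z (psi lam phi k))
                        (psi lam phi k))"

definition admissible ::
  "'a::chilbert_space set \<Rightarrow> 'a set \<Rightarrow> ('a \<Rightarrow> 'a) \<Rightarrow> (nat \<Rightarrow> real) \<Rightarrow> (nat \<Rightarrow> 'a)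
     \<Rightarrow> ('a \<Rightarrow> 'b::chilbert_space) \<Rightarrow> bool" where
  "admissible D0 D1 B lam phi C0 \<longleftrightarrow>
     (\<forall>T>0. \<exists>K>0. \<forall>z\<in>dom_A D0 D1.
        (\<integral>\<^sup>+t\<in>{0..T}. ennreal ((norm (op_C C0 (exp_itA B lam phi t z)))\<^sup>2) \<partial>lborel)
          \<le> ennreal (K * (X_norm B z)\<^sup>2))"

section \<open>Frequency functions and spectral coercivity\<close>

(* A is self-adjoint on X, so X_inner B (op_A A0 z) z is real for z in its domain. *)
definition freq_A :: "('a::chilbert_space \<Rightarrow> 'a) \<Rightarrow> ('a \<Rightarrow> 'a) \<Rightarrow> 'a \<times> 'a \<Rightarrow> real" where
  "freq_A A0 B z = Re (X_inner B (op_A A0 z) z) / (X_norm B z)\<^sup>2"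

definition freq_absA ::
  "('a::chilbert_space \<Rightarrow> 'a) \<Rightarrow> (nat \<Rightarrow> real) \<Rightarrow> (nat \<Rightarrow> 'a) \<Rightarrow> 'a \<times> 'a \<Rightarrow> real" where
  "freq_absA B lam phi z =
     (\<Sum>\<^sub>\<infinity>k\<in>-{0}. lam (nat \<bar>k\<bar>) * (cmod (X_inner B z (psi lam phi k)))\<^sup>2) /
     (\<Sum>\<^sub>\<infinity>k\<in>-{0}. (cmod (X_inner B z (psi lam phi k)))\<^sup>2)"

definition Sigma_d :: "(real \<Rightarrow> real) set" where
  "Sigma_d = {f. (\<forall>x. f x > 0) \<and> (\<forall>x. f (- x) = f x) \<and> continuous_on UNIV f \<and>
                 antimono_on {0..} f}"

definition spectrally_coercive ::
  "'a::chilbert_space set \<Rightarrow> ('a \<Rightarrow> 'a) \<Rightarrow> 'a set \<Rightarrow> ('a \<Rightarrow> 'a) \<Rightarrow> (nat \<Rightarrow> real) \<Rightarrow> (nat \<Rightarrow> 'a)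
     \<Rightarrow> ('a \<Rightarrow> 'b::chilbert_space) \<Rightarrow> bool" where
  "spectrally_coercive D0 A0 D1 B lam phi C0 \<longleftrightarrow>
     (\<exists>\<epsilon>\<in>Sigma_d. \<exists>\<Psi>\<in>Sigma_d. \<forall>z\<in>dom_A D0 D1 - {0}.
        (X_norm B (op_A A0 z))\<^sup>2 / (X_norm B z)\<^sup>2 - (freq_A A0 B z)\<^sup>2 \<le> \<epsilon> (freq_absA B lam phi z)
        \<longrightarrow> (norm (op_C C0 z))\<^sup>2 \<ge> \<Psi> (freq_absA B lam phi z) * (X_norm B z)\<^sup>2)"

end

theory Submission
  imports Defs
begin

text \<open>Write \<open>V z = \<parallel>A z\<parallel>\<^sup>2 / \<parallel>z\<parallel>\<^sup>2 - \<lambda>\<^sub>A(z)\<^sup>2\<close> for the variance of \<open>A\<close> in the state \<open>z\<close>.  Expanding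
  the square gives
  \<open>\<parallel>(A - r) z\<parallel>\<^sup>2 = (V z + (r - \<lambda>\<^sub>A(z))\<^sup>2) \<parallel>z\<parallel>\<^sup>2\<close> for every real \<open>r\<close>
  (lemma \<open>X_norm_shift_eq_variance\<close>).  The second term of the maximum is therefore
  \<open>\<parallel>z\<parallel>\<^sup>2\<close> times \<open>(V z + (r - \<lambda>\<^sub>A(z))\<^sup>2) / (\<epsilon> + (r - \<lambda>\<^sub>A(z))\<^sup>2)\<close>, and it is at least \<open>\<parallel>z\<parallel>\<^sup>2\<close> exactly when
  \<open>V z \<ge> \<epsilon>\<close>, whatever \<open>r\<close> is.  So the resolvent inequality is the alternative "either the
  variance is at least \<open>\<epsilon>\<close> or \<open>C z\<close> is large", which is spectral coercivity up to the
  borderline case \<open>V z = \<epsilon>\<close>.  From coercivity to the resolvent inequality the functions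
  \<open>\<epsilon>\<close> and \<open>\<Psi>\<close> can be kept; in the other direction \<open>\<epsilon>\<close> is halved, so that the hypothesis of coercivity
  forces the strict inequality that excludes the second term.\<close>

lemma power2_norm_eq_cinner: "(norm (x::'a::chilbert_space))\<^sup>2 = Re (cinner x x)"
proof -
  have "0 \<le> Re (cinner x x)"
    using norm_ge_zero[of x] unfolding norm_eq_sqrt_cinner real_sqrt_ge_0_iff .
  then show ?thesis
    by (simp add: norm_eq_sqrt_cinner)
qed

lemma cinner_zero_left [simp]: "cinner 0 (y::'a::chilbert_space) = 0"
  using cinner_add_left[of 0 0 y] by simp

lemma Re_cinner_commute: "Re (cinner x (y::'a::chilbert_space)) = Re (cinner y x)"
  by (subst cinner_commute) simp

lemma power2_norm_diff_scaleR:
  fixes x y :: "'a::chilbert_space"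
  shows "(norm (x - r *\<^sub>R y))\<^sup>2 = (norm x)\<^sup>2 - 2 * r * Re (cinner x y) + r\<^sup>2 * (norm y)\<^sup>2"
proof -
  define w where "w = complex_of_real (- r) *\<^sub>C y"
  have diff: "x - r *\<^sub>R y = x + w"
    unfolding w_def scaleC_of_real by simp
  have left: "Re (cinner w z) = - r * Re (cinner y z)" for z
    unfolding w_def cinner_scaleC_left by simp
  have right: "Re (cinner z w) = - r * Re (cinner z y)" for z
    using left[of z] by (simp add: Re_cinner_commute[of z])
  have "(norm (x + w))\<^sup>2 = Re (cinner x (x + w)) + Re (cinner w (x + w))"
    by (simp add: power2_norm_eq_cinner cinner_add_left)
  also have "\<dots> = Re (cinner x x) + Re (cinner x w) + (Re (cinner w x) + Re (cinner w w))"
    by (simp add: Re_cinner_commute[of _ "x + w"] cinner_add_left Re_cinner_commute[of w x])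
  also have "\<dots> = (norm x)\<^sup>2 - 2 * r * Re (cinner x y) + r\<^sup>2 * (norm y)\<^sup>2"
    by (simp add: left right power2_norm_eq_cinner Re_cinner_commute[of y x] power2_eq_square[of r])
  finally show ?thesis
    unfolding diff .
qed

lemma clinear_on_diff_scaleR:
  assumes "clinear_on D T" "x \<in> D" "y \<in> D"
  shows "T (x - r *\<^sub>R y) = T x - r *\<^sub>R T y"
proof -
  have "T (x + complex_of_real (- r) *\<^sub>C y) = T x + complex_of_real (- r) *\<^sub>C T y"
    using assms unfolding clinear_on_def by metis
  then show ?thesis
    unfolding scaleC_of_real by simp
qed

lemma power2_X_norm: "(X_norm B z)\<^sup>2 = (norm (B (fst z)))\<^sup>2 + (norm (snd z))\<^sup>2"
  unfolding X_norm_def by simp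

lemma power2_X_norm_diff_scaleR:
  assumes "clinear_on D1 B" "fst w \<in> D1" "fst z \<in> D1"
  shows "(X_norm B (w - r *\<^sub>R z))\<^sup>2
    = (X_norm B w)\<^sup>2 - 2 * r * Re (X_inner B w z) + r\<^sup>2 * (X_norm B z)\<^sup>2"
  by (simp add: power2_X_norm X_inner_def clinear_on_diff_scaleR[OF assms] power2_norm_diff_scaleR
      distrib_left)

text \<open>On \<open>X\<close> the map \<open>X_norm\<close> is a norm and not merely a seminorm because \<open>B\<close>, being
  positive, is injective on its domain.\<close>

lemma X_norm_pos:
  assumes "positive_op D1 B" "fst z \<in> D1" "z \<noteq> 0"
  shows "X_norm B z > 0"
proof -
  have "B (fst z) \<noteq> 0 \<or> snd z \<noteq> 0"
  proof (rule ccontr)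
    assume "\<not> (B (fst z) \<noteq> 0 \<or> snd z \<noteq> 0)"
    then have zero: "B (fst z) = 0" "snd z = 0" by auto
    with \<open>z \<noteq> 0\<close> have "fst z \<noteq> 0"
      by (auto simp: prod_eq_iff)
    with assms have "Re (cinner (B (fst z)) (fst z)) > 0"
      unfolding positive_op_def by blast
    with zero show False by simp
  qed
  then show ?thesis
    unfolding X_norm_def by (auto intro: add_pos_nonneg add_nonneg_pos)
qed

text \<open>This is the decomposition of the second moment of \<open>A\<close> about \<open>r\<close> into the variance and the
  squared distance of \<open>r\<close> from the mean \<open>freq_A\<close>.\<close>

lemma X_norm_shift_eq_variance:
  assumes "clinear_on D1 B" "fst (op_A A0 z) \<in> D1" "fst z \<in> D1" "X_norm B z > 0"
  shows "(X_norm B (op_A A0 z - r *\<^sub>R z))\<^sup>2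
    = ((X_norm B (op_A A0 z))\<^sup>2 / (X_norm B z)\<^sup>2 - (freq_A A0 B z)\<^sup>2 + (r - freq_A A0 B z)\<^sup>2)
        * (X_norm B z)\<^sup>2"
proof -
  define m where "m = freq_A A0 B z"
  have "Re (X_inner B (op_A A0 z) z) = m * (X_norm B z)\<^sup>2"
    using assms(4) unfolding m_def freq_A_def by simp
  moreover have "(X_norm B (op_A A0 z))\<^sup>2
      = (X_norm B (op_A A0 z))\<^sup>2 / (X_norm B z)\<^sup>2 * (X_norm B z)\<^sup>2"
    using assms(4) by simp
  ultimately show ?thesis
    unfolding power2_X_norm_diff_scaleR[OF assms(1-3)] m_def[symmetric]
    by (simp add: algebra_simps power2_diff)
qed

lemma Sigma_d_half:
  assumes "f \<in> Sigma_d"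
  shows "(\<lambda>x. f x / 2) \<in> Sigma_d"
  using assms unfolding Sigma_d_def monotone_on_def
  by (auto intro!: continuous_intros)

text \<open>With \<open>V\<close> the variance, \<open>n\<close> the squared norm and \<open>s\<close> the offset of \<open>r\<close> from the mean, the
  shift \<open>s\<close> cancels from the comparison of the resolvent term with \<open>n\<close>.\<close>

lemma le_resolvent_term_iff:
  fixes V s e n :: real
  assumes "e > 0" "n > 0"
  shows "n \<le> (V + s\<^sup>2) * n / (s\<^sup>2 + e) \<longleftrightarrow> e \<le> V"
proof -
  have "s\<^sup>2 + e > 0"
    using \<open>e > 0\<close> by (simp add: add_nonneg_pos)
  then have "n \<le> (V + s\<^sup>2) * n / (s\<^sup>2 + e) \<longleftrightarrow> (s\<^sup>2 + e) * n \<le> (V + s\<^sup>2) * n"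
    by (simp add: pos_le_divide_eq mult.commute)
  also have "\<dots> \<longleftrightarrow> e \<le> V"
    using \<open>n > 0\<close> by simp
  finally show ?thesis .
qed

theorem theorem2p1:
  fixes D0 D1 :: "'h::chilbert_space set"
    and A0 B :: "'h \<Rightarrow> 'h"
    and lam :: "nat \<Rightarrow> real"
    and phi :: "nat \<Rightarrow> 'h"
    and C0 :: "'h \<Rightarrow> 'y::chilbert_space"
  assumes "unbounded_op D0 A0"
    and "self_adjoint D0 A0"
    and "positive_op D0 A0"
    and "compact_resolvent D0 A0"
    and "positive_sqrt_of D0 A0 D1 B"
    and "ordered_eigenbasis D1 B lam phi"
    and "bounded_clinear_on_graph D0 A0 C0"
    and "admissible D0 D1 B lam phi C0"
  shows "spectrally_coercive D0 A0 D1 B lam phi C0 \<longleftrightarrow>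
    (\<exists>\<Psi>\<in>Sigma_d. \<exists>\<epsilon>\<in>Sigma_d. \<forall>r::real. \<forall>z\<in>dom_A D0 D1 - {0}.
       (X_norm B z)\<^sup>2 \<le>
         max ((norm (op_C C0 z))\<^sup>2 / \<Psi> (freq_absA B lam phi z))
             ((X_norm B (op_A A0 z - r *\<^sub>R z))\<^sup>2 /
                ((r - freq_A A0 B z)\<^sup>2 + \<epsilon> (freq_absA B lam phi z))))"
proof -
  define V where "V z = (X_norm B (op_A A0 z))\<^sup>2 / (X_norm B z)\<^sup>2 - (freq_A A0 B z)\<^sup>2" for z
  let ?F = "freq_absA B lam phi"
  have lin: "clinear_on D1 B" and pos: "positive_op D1 B" and D0: "D0 \<subseteq> D1"
    using \<open>positive_sqrt_of D0 A0 D1 B\<close>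
    unfolding positive_sqrt_of_def self_adjoint_def by auto
  have fst_D1: "fst z \<in> D1" "fst (op_A A0 z) \<in> D1" if "z \<in> dom_A D0 D1 - {0}" for z
    using that D0 lin unfolding dom_A_def op_A_def clinear_on_def by auto
  have norm_pos: "X_norm B z > 0" if "z \<in> dom_A D0 D1 - {0}" for z
    using X_norm_pos[OF pos] fst_D1[OF that] that by blast
  have observation: "(X_norm B z)\<^sup>2 \<le> (norm (op_C C0 z))\<^sup>2 / \<Psi> (?F z)
      \<longleftrightarrow> \<Psi> (?F z) * (X_norm B z)\<^sup>2 \<le> (norm (op_C C0 z))\<^sup>2" if "\<Psi> \<in> Sigma_d" for \<Psi> z
    using that unfolding Sigma_d_def by (simp add: pos_le_divide_eq mult.commute)
  have resolvent: "(X_norm B z)\<^sup>2 \<le> (X_norm B (op_A A0 z - r *\<^sub>R z))\<^sup>2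
        / ((r - freq_A A0 B z)\<^sup>2 + \<epsilon> (?F z)) \<longleftrightarrow> \<epsilon> (?F z) \<le> V z"
    if "\<epsilon> \<in> Sigma_d" "z \<in> dom_A D0 D1 - {0}" for \<epsilon> r z
  proof -
    have "\<epsilon> (?F z) > 0" "(X_norm B z)\<^sup>2 > 0"
      using that(1) norm_pos[OF that(2)] unfolding Sigma_d_def by auto
    then show ?thesis
      unfolding X_norm_shift_eq_variance[OF lin fst_D1(2,1)[OF that(2)] norm_pos[OF that(2)]]
        V_def[symmetric]
      by (rule le_resolvent_term_iff)
  qed
  show ?thesis
    unfolding spectrally_coercive_def V_def[symmetric] le_max_iff_disj
  proof (intro iffI; elim bexE)
    fix \<epsilon> \<Psi>
    assume Sigma: "\<epsilon> \<in> Sigma_d" "\<Psi> \<in> Sigma_d"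
      and coercive: "\<forall>z\<in>dom_A D0 D1 - {0}. V z \<le> \<epsilon> (?F z)
        \<longrightarrow> \<Psi> (?F z) * (X_norm B z)\<^sup>2 \<le> (norm (op_C C0 z))\<^sup>2"
    show "\<exists>\<Psi>\<in>Sigma_d. \<exists>\<epsilon>\<in>Sigma_d. \<forall>r. \<forall>z\<in>dom_A D0 D1 - {0}.
        (X_norm B z)\<^sup>2 \<le> (norm (op_C C0 z))\<^sup>2 / \<Psi> (?F z) \<or>
        (X_norm B z)\<^sup>2 \<le> (X_norm B (op_A A0 z - r *\<^sub>R z))\<^sup>2
          / ((r - freq_A A0 B z)\<^sup>2 + \<epsilon> (?F z))"
    proof (rule bexI[OF _ Sigma(2)], rule bexI[OF _ Sigma(1)], intro allI ballI)
      fix r z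
      assume z: "z \<in> dom_A D0 D1 - {0}"
      show "(X_norm B z)\<^sup>2 \<le> (norm (op_C C0 z))\<^sup>2 / \<Psi> (?F z) \<or>
        (X_norm B z)\<^sup>2 \<le> (X_norm B (op_A A0 z - r *\<^sub>R z))\<^sup>2
          / ((r - freq_A A0 B z)\<^sup>2 + \<epsilon> (?F z))"
        unfolding observation[OF Sigma(2)] resolvent[OF Sigma(1) z]
        using coercive z by (meson linear)
    qed
  next
    fix \<Psi> \<epsilon>
    assume Sigma: "\<Psi> \<in> Sigma_d" "\<epsilon> \<in> Sigma_d"
      and ineq: "\<forall>r. \<forall>z\<in>dom_A D0 D1 - {0}.
        (X_norm B z)\<^sup>2 \<le> (norm (op_C C0 z))\<^sup>2 / \<Psi> (?F z) \<or>
        (X_norm B z)\<^sup>2 \<le> (X_norm B (op_A A0 z - r *\<^sub>R z))\<^sup>2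
          / ((r - freq_A A0 B z)\<^sup>2 + \<epsilon> (?F z))"
    show "\<exists>\<epsilon>\<in>Sigma_d. \<exists>\<Psi>\<in>Sigma_d. \<forall>z\<in>dom_A D0 D1 - {0}. V z \<le> \<epsilon> (?F z)
        \<longrightarrow> \<Psi> (?F z) * (X_norm B z)\<^sup>2 \<le> (norm (op_C C0 z))\<^sup>2"
    proof (rule bexI[OF _ Sigma_d_half[OF Sigma(2)]], rule bexI[OF _ Sigma(1)], intro ballI impI)
      fix z
      assume z: "z \<in> dom_A D0 D1 - {0}" and small: "V z \<le> \<epsilon> (?F z) / 2"
      have "\<epsilon> (?F z) > 0"
        using Sigma(2) unfolding Sigma_d_def by simp
      with small have "\<not> \<epsilon> (?F z) \<le> V z" by linarith
      \<comment> \<open>Any shift would do here, as the resolvent alternative does not depend on it.\<close>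
      with ineq[rule_format, OF z, of 0]
      show "\<Psi> (?F z) * (X_norm B z)\<^sup>2 \<le> (norm (op_C C0 z))\<^sup>2"
        unfolding observation[OF Sigma(1)] resolvent[OF Sigma(2) z] by blast
    qed
  qed
qed

end
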